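(* Let $b\ge 2$ and $\rho\ge 1$ be integers, let $\Lambda=(\lambda_1,\ldots,\lambda_\rho)$ be a sequence of integers with $1\le\lambda_1\le\cdots\le\lambda_\rho$, and let $\lambda=\lambda_1+\cdots+\lambda_\rho$. Then the sequence $C_b^\Lambda(n)$ of numbers of $\Lambda$-restricted $\rho$-color $b$-ary partitions of $n$ satisfies, for all integers $n\ge 0$, the recurrence relation $$C_b^\Lambda(bn+j)=\sum_{k=0}^{\lfloor\lambda/b\rfloor}Y_{bk+j}\,C_b^\Lambda(n-k)\qquad (j=0,1,\ldots,b-1),$$ where $Y_0=1$ and, for $n\ge 1$, $Y_n$ is the number of $\rho$-color ordinary partitions of $n$ which have at most one part of each color and in which a part of color $i$ is bounded by $\lambda_i$ ($1\le i\le\rho$).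
   Context: A $\Lambda$-restricted $\rho$-color $b$-ary partition of an integer $n\ge 1$ is a finite multiset of colored parts, each being a power $b^j$ ($j\ge 0$) with a color $r\in\{1,\dots,\rho\}$, with sum $n$, in which for each $j\ge0$ and each $r$ the power $b^j$ with color $r$ occurs at most $\lambda_r$ times. $C_b^\Lambda(n)$ is the number of these, with $C_b^\Lambda(0)=1$ and $C_b^\Lambda(m)=0$ for $m<0$; equivalently, $\sum_{n\ge0}C_b^\Lambda(n)q^n=\prod_{j=0}^\infty\prod_{r=1}^\rho\left(1+q^{b^j}+q^{2b^j}+\cdots+q^{\lambda_r b^j}\right)$. A $\rho$-color ordinary partition of $n$ is a finite multiset of positive integers, each assigned a color from $\{1,\dots,\rho\}$, with sum $n$ (order irrelevant). *)

theory Defs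
  imports Main "HOL-Library.Multiset"
begin

text \<open>A coloured part is a pair of its size and its colour; the colours are \<open>1, \<dots>, \<rho>\<close>.\<close>

definition colored_partitions :: "nat \<Rightarrow> nat \<Rightarrow> (nat \<times> nat) multiset set" where
  "colored_partitions \<rho> n =
     {M. (\<forall>(a, r) \<in> set_mset M. 1 \<le> a \<and> r \<in> {1..\<rho>}) \<and> (\<Sum>(a, r) \<in># M. a) = n}"

definition restricted_bary_partitions ::
    "nat \<Rightarrow> nat \<Rightarrow> (nat \<Rightarrow> nat) \<Rightarrow> nat \<Rightarrow> (nat \<times> nat) multiset set" where
  "restricted_bary_partitions b \<rho> \<Lambda> n =
     {M \<in> colored_partitions \<rho> n.
        (\<forall>(a, r) \<in> set_mset M. \<exists>j. a = b ^ j) \<and>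
        (\<forall>j. \<forall>r \<in> {1..\<rho>}. count M (b ^ j, r) \<le> \<Lambda> r)}"

text \<open>
  The counting function takes an integer argument because the recurrence evaluates it at
  negative arguments.
\<close>

definition C :: "nat \<Rightarrow> nat \<Rightarrow> (nat \<Rightarrow> nat) \<Rightarrow> int \<Rightarrow> nat" where
  "C b \<rho> \<Lambda> m =
     (if m < 0 then 0
      else if m = 0 then 1
      else card (restricted_bary_partitions b \<rho> \<Lambda> (nat m)))"

definition Y :: "nat \<Rightarrow> (nat \<Rightarrow> nat) \<Rightarrow> nat \<Rightarrow> nat" where
  "Y \<rho> \<Lambda> n =
     (if n = 0 then 1
      else card {M \<in> colored_partitions \<rho> n.
        (\<forall>i \<in> {1..\<rho>}. size {# p \<in># M. snd p = i #} \<le> 1) \<and>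
        (\<forall>(a, i) \<in> set_mset M. a \<le> \<Lambda> i)})"

end

theory Submission
  imports Defs "HOL-Library.FuncSet"
begin

text \<open>
  Fix a partition of \<open>b * n + j\<close> into coloured powers of \<open>b\<close>. For each colour \<open>i\<close> it contains
  some number \<open>f i \<le> \<Lambda> i\<close> of parts \<open>1\<close>; every other part is divisible by \<open>b\<close>, and dividing these
  parts by \<open>b\<close> leaves an arbitrary restricted partition \<open>N\<close>. Thus the
  partition is the same thing as a pair \<open>(f, N)\<close> with \<open>|f| + b * weight N = b * n + j\<close>, where
  \<open>|f|\<close> is the sum of the entries of \<open>f\<close>
  (\<open>assemble_in_restricted_iff\<close>, \<open>assemble_decompose\<close>). Since \<open>j < b\<close>, this equation says that
  \<open>|f| = b * k + j\<close> and \<open>weight N = n - k\<close> for a unique \<open>k \<le> n\<close>; and \<open>|f| \<le> |\<Lambda>|\<close>,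
  which bounds \<open>k\<close> by \<open>|\<Lambda>| div b\<close>.

  It remains to see that \<open>Y m\<close> counts the vectors \<open>f \<le> \<Lambda>\<close> with \<open>|f| = m\<close>. Indeed, such a vector
  is a coloured partition with at most one part of each colour, the part of colour \<open>i\<close> being \<open>f i\<close>,
  where \<open>f i = 0\<close> means that the colour does not occur (\<open>Y_eq_card_profiles\<close>).
\<close>

section \<open>Coloured multisets and profiles\<close>

definition weight :: "(nat \<times> nat) multiset \<Rightarrow> nat" where
  "weight M = (\<Sum>p\<in>#M. fst p)"

lemma weight_simps [simp]:
  "weight {#} = 0" "weight (M + N) = weight M + weight N"
  by (simp_all add: weight_def)

lemma weight_sum: "weight (\<Sum>i\<in>A. g i) = (\<Sum>i\<in>A. weight (g i))"
  by (induction A rule: infinite_finite_induct) simp_all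

lemma fst_le_weight:
  assumes "p \<in># M"
  shows "fst p \<le> weight M"
proof -
  obtain N where "M = add_mset p N" using assms by (rule multi_member_split[THEN exE])
  then show ?thesis by (simp add: weight_def)
qed

lemma in_colored_partitions_iff:
  "M \<in> colored_partitions \<rho> n \<longleftrightarrow>
     (\<forall>a r. (a, r) \<in># M \<longrightarrow> 1 \<le> a \<and> r \<in> {1..\<rho>}) \<and> weight M = n"
  by (auto simp: colored_partitions_def weight_def case_prod_beta')

lemma in_restricted_bary_partitions_iff:
  "M \<in> restricted_bary_partitions b \<rho> \<Lambda> n \<longleftrightarrow>
     (\<forall>a r. (a, r) \<in># M \<longrightarrow> 1 \<le> a \<and> r \<in> {1..\<rho>} \<and> (\<exists>j. a = b ^ j)) \<and>
     (\<forall>j. \<forall>r\<in>{1..\<rho>}. count M (b ^ j, r) \<le> \<Lambda> r) \<and> weight M = n"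
  unfolding restricted_bary_partitions_def in_colored_partitions_iff by fast

text \<open>There are at most \<open>n\<close> parts, each of them among the finitely many coloured numbers up to \<open>n\<close>.\<close>

lemma finite_colored_partitions: "finite (colored_partitions \<rho> n)"
proof -
  let ?A = "{1..n} \<times> {1..\<rho>}"
  have "colored_partitions \<rho> n \<subseteq> mset ` {xs. set xs \<subseteq> ?A \<and> length xs \<le> n}"
  proof
    fix M assume M: "M \<in> colored_partitions \<rho> n"
    obtain xs where xs: "mset xs = M" using ex_mset by blast
    have w: "weight M = n" and pos: "\<And>p. p \<in># M \<Longrightarrow> 1 \<le> fst p \<and> snd p \<in> {1..\<rho>}"
      using M by (auto simp: in_colored_partitions_iff)
    have "size M = (\<Sum>p\<in>#M. 1)" by (rule size_eq_sum_mset)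
    also have "\<dots> \<le> weight M"
      unfolding weight_def by (rule sum_mset_mono) (use pos in auto)
    finally have size: "size M \<le> n" using w by simp
    have "fst p \<le> n" if "p \<in># M" for p
      using fst_le_weight[OF that] w by simp
    then have "set_mset M \<subseteq> ?A" using pos by (simp add: subset_iff mem_Times_iff)
    then have "set xs \<subseteq> ?A" using xs by auto
    moreover have "length xs \<le> n" using size xs by auto
    ultimately show "M \<in> mset ` {xs. set xs \<subseteq> ?A \<and> length xs \<le> n}" using xs by blast
  qed
  then show ?thesis
    by (rule finite_subset) (simp add: finite_lists_length_le)
qed

text \<open>
  The common form of the data on both sides of the recurrence: the multiplicities of the part
  \<open>1\<close> in a \<open>b\<close>-ary partition, and the parts of a partition with at most one part per colour.
  The extensional function space makes such a vector determined by its entries at the colours,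
  so that counting the functions counts the vectors.
\<close>

definition profiles :: "nat \<Rightarrow> (nat \<Rightarrow> nat) \<Rightarrow> nat \<Rightarrow> (nat \<Rightarrow> nat) set" where
  "profiles \<rho> \<Lambda> m = {f \<in> (\<Pi>\<^sub>E i\<in>{1..\<rho>}. {..\<Lambda> i}). (\<Sum>i = 1..\<rho>. f i) = m}"

lemma finite_profiles: "finite (profiles \<rho> \<Lambda> m)"
  unfolding profiles_def by (rule finite_subset[of _ "\<Pi>\<^sub>E i\<in>{1..\<rho>}. {..\<Lambda> i}"]) (auto intro: finite_PiE)

section \<open>Partitions with one part per colour\<close>

definition distinct_color_partitions ::
    "nat \<Rightarrow> (nat \<Rightarrow> nat) \<Rightarrow> nat \<Rightarrow> (nat \<times> nat) multiset set" where
  "distinct_color_partitions \<rho> \<Lambda> n = {M \<in> colored_partitions \<rho> n.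
        (\<forall>i \<in> {1..\<rho>}. size {# p \<in># M. snd p = i #} \<le> 1) \<and>
        (\<forall>(a, i) \<in> set_mset M. a \<le> \<Lambda> i)}"

definition one_part_per_color :: "nat \<Rightarrow> (nat \<Rightarrow> nat) \<Rightarrow> (nat \<times> nat) multiset" where
  "one_part_per_color \<rho> f = image_mset (\<lambda>i. (f i, i)) (mset_set {i \<in> {1..\<rho>}. 0 < f i})"

definition color_weights :: "nat \<Rightarrow> (nat \<times> nat) multiset \<Rightarrow> nat \<Rightarrow> nat" where
  "color_weights \<rho> M = restrict (\<lambda>i. weight {# p \<in># M. snd p = i #}) {1..\<rho>}"

lemma filter_color_one_part_per_color:
  "{# p \<in># one_part_per_color \<rho> f. snd p = i #} =
     (if i \<in> {1..\<rho>} \<and> 0 < f i then {#(f i, i)#} else {#})"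
proof -
  have "{k \<in> {1..\<rho>}. 0 < f k \<and> k = i} = (if i \<in> {1..\<rho>} \<and> 0 < f i then {i} else {})"
    by auto
  moreover have "{# p \<in># one_part_per_color \<rho> f. snd p = i #} =
      image_mset (\<lambda>i. (f i, i)) (mset_set {k \<in> {1..\<rho>}. 0 < f k \<and> k = i})"
    by (simp add: one_part_per_color_def filter_mset_image_mset conj_assoc)
  ultimately show ?thesis by auto
qed

lemma weight_one_part_per_color: "weight (one_part_per_color \<rho> f) = (\<Sum>i = 1..\<rho>. f i)"
proof -
  have "weight (one_part_per_color \<rho> f) = (\<Sum>i\<in>{i \<in> {1..\<rho>}. 0 < f i}. f i)"
    by (simp add: weight_def one_part_per_color_def sum_unfold_sum_mset image_mset.compositionality o_def)
  also have "\<dots> = (\<Sum>i = 1..\<rho>. f i)"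
    by (rule sum.mono_neutral_left) auto
  finally show ?thesis .
qed

lemma one_part_per_color_in_distinct_color_partitions:
  assumes "f \<in> profiles \<rho> \<Lambda> m"
  shows "one_part_per_color \<rho> f \<in> distinct_color_partitions \<rho> \<Lambda> m"
proof -
  have "(a, r) \<in># one_part_per_color \<rho> f \<Longrightarrow> r \<in> {1..\<rho>} \<and> a = f r \<and> 0 < a" for a r
    by (auto simp: one_part_per_color_def)
  then show ?thesis
    using assms
    by (fastforce simp: distinct_color_partitions_def in_colored_partitions_iff profiles_def
        weight_one_part_per_color filter_color_one_part_per_color)
qed

lemma color_weights_one_part_per_color:
  assumes "f \<in> profiles \<rho> \<Lambda> m"
  shows "color_weights \<rho> (one_part_per_color \<rho> f) = f"
proof
  fix i
  show "color_weights \<rho> (one_part_per_color \<rho> f) i = f i"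
    using assms
    by (auto simp: color_weights_def filter_color_one_part_per_color weight_def profiles_def
        PiE_def extensional_def)
qed

text \<open>
  A multiset is determined by its submultisets of each colour. Here each of these is empty or a
  single part, and as parts are positive, its weight tells which.
\<close>

lemma one_part_per_color_color_weights:
  assumes M: "M \<in> distinct_color_partitions \<rho> \<Lambda> m"
  shows "one_part_per_color \<rho> (color_weights \<rho> M) = M"
    and "color_weights \<rho> M \<in> profiles \<rho> \<Lambda> m"
proof -
  have parts: "1 \<le> a \<and> i \<in> {1..\<rho>} \<and> a \<le> \<Lambda> i" if "(a, i) \<in># M" for a i
    using M that by (auto simp: distinct_color_partitions_def in_colored_partitions_iff)
  have color: "{# p \<in># M. snd p = i #} = {#} \<or>
      (\<exists>a. (a, i) \<in># M \<and> {# p \<in># M. snd p = i #} = {#(a, i)#})" if i: "i \<in> {1..\<rho>}" for i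
  proof -
    have "size {# p \<in># M. snd p = i #} \<le> 1"
      using M i by (auto simp: distinct_color_partitions_def)
    then consider "{# p \<in># M. snd p = i #} = {#}" | p where "{# p \<in># M. snd p = i #} = {#p#}"
      by (metis le_neq_implies_less less_one size_1_singleton_mset size_eq_0_iff_empty)
    then show ?thesis
    proof cases
      case 2
      have "p \<in># {# p \<in># M. snd p = i #}" unfolding 2 by simp
      then have "(fst p, i) \<in># M" "p = (fst p, i)" by auto
      then show ?thesis using 2 by metis
    qed simp
  qed
  have filters: "{# p \<in># one_part_per_color \<rho> (color_weights \<rho> M). snd p = i #} =
      {# p \<in># M. snd p = i #}" for i
  proof (cases "i \<in> {1..\<rho>}")
    case True
    consider "{# p \<in># M. snd p = i #} = {#}" |
        a where "1 \<le> a" "{# p \<in># M. snd p = i #} = {#(a, i)#}"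
      using color[OF True] parts by blast
    then show ?thesis
    proof cases
      case 1
      have "color_weights \<rho> M i = 0"
        using True unfolding color_weights_def by (simp only: restrict_apply' 1 weight_simps)
      then show ?thesis unfolding filter_color_one_part_per_color 1 by simp
    next
      case (2 a)
      have "color_weights \<rho> M i = a"
        using True unfolding color_weights_def by (simp add: 2(2) weight_def)
      then show ?thesis unfolding filter_color_one_part_per_color 2(2) using True 2(1) by simp
    qed
  next
    case False
    then have none: "{# p \<in># M. snd p = i #} = {#}"
      using parts by auto
    show ?thesis unfolding filter_color_one_part_per_color none using False by auto
  qed
  show eq: "one_part_per_color \<rho> (color_weights \<rho> M) = M"
  proof (rule multiset_eqI)
    fix p
    show "count (one_part_per_color \<rho> (color_weights \<rho> M)) p = count M p"
      using arg_cong[OF filters[of "snd p"], of "\<lambda>A. count A p"] by simp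
  qed
  have "(\<Sum>i = 1..\<rho>. color_weights \<rho> M i) = m"
    using weight_one_part_per_color[of \<rho> "color_weights \<rho> M"] M
    by (simp add: eq distinct_color_partitions_def in_colored_partitions_iff)
  moreover have "color_weights \<rho> M i \<le> \<Lambda> i" if "i \<in> {1..\<rho>}" for i
    using color[OF that] parts that
    by (auto simp: color_weights_def weight_def simp del: filter_mset_eq_mempty_iff)
  ultimately show "color_weights \<rho> M \<in> profiles \<rho> \<Lambda> m"
    by (auto simp: profiles_def color_weights_def)
qed

lemma Y_eq_card_profiles: "Y \<rho> \<Lambda> m = card (profiles \<rho> \<Lambda> m)"
proof -
  have "bij_betw (one_part_per_color \<rho>) (profiles \<rho> \<Lambda> m) (distinct_color_partitions \<rho> \<Lambda> m)"
    by (rule bij_betw_byWitness[of _ "color_weights \<rho>"])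
      (auto simp: color_weights_one_part_per_color one_part_per_color_color_weights
        one_part_per_color_in_distinct_color_partitions)
  then have card: "card (profiles \<rho> \<Lambda> m) = card (distinct_color_partitions \<rho> \<Lambda> m)"
    by (rule bij_betw_same_card)
  show ?thesis
  proof (cases "m = 0")
    case True
    (* Y gives the value at 0 separately; it agrees with the count, as the zero vector is the
       only profile of total 0. *)
    have "profiles \<rho> \<Lambda> 0 = {restrict (\<lambda>_. 0) {1..\<rho>}}"
      by (auto simp: profiles_def fun_eq_iff PiE_def extensional_def)
    then show ?thesis using True by (simp add: Y_def)
  next
    case False
    then show ?thesis by (simp add: Y_def card distinct_color_partitions_def)
  qed
qed

section \<open>Splitting off the parts equal to one\<close>

definition ones :: "nat \<Rightarrow> (nat \<Rightarrow> nat) \<Rightarrow> (nat \<times> nat) multiset" where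
  "ones \<rho> f = (\<Sum>i = 1..\<rho>. replicate_mset (f i) (1, i))"

definition assemble :: "nat \<Rightarrow> nat \<Rightarrow> (nat \<Rightarrow> nat) \<Rightarrow> (nat \<times> nat) multiset \<Rightarrow> (nat \<times> nat) multiset"
  where "assemble b \<rho> f N = ones \<rho> f + image_mset (\<lambda>(a, r). (b * a, r)) N"

definition decompose :: "nat \<Rightarrow> nat \<Rightarrow> (nat \<times> nat) multiset \<Rightarrow> (nat \<Rightarrow> nat) \<times> (nat \<times> nat) multiset"
  where "decompose b \<rho> M =
    (restrict (\<lambda>i. count M (1, i)) {1..\<rho>},
     image_mset (\<lambda>(a, r). (a div b, r)) {# p \<in># M. fst p \<noteq> 1 #})"

lemma count_ones: "count (ones \<rho> f) (a, i) = (if a = 1 \<and> i \<in> {1..\<rho>} then f i else 0)"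
proof -
  have "count (ones \<rho> f) (a, i) = (\<Sum>k = 1..\<rho>. if k = i then (if a = 1 then f i else 0) else 0)"
    unfolding ones_def count_sum by (rule sum.cong) auto
  then show ?thesis by (simp add: sum.delta)
qed

lemma weight_ones: "weight (ones \<rho> f) = (\<Sum>i = 1..\<rho>. f i)"
proof -
  have "weight (replicate_mset k (1, i)) = k" for k i
    by (induction k) (simp_all add: weight_def)
  then show ?thesis by (simp add: ones_def weight_sum)
qed

lemma weight_assemble: "weight (assemble b \<rho> f N) = (\<Sum>i = 1..\<rho>. f i) + b * weight N"
proof -
  have "weight (image_mset (\<lambda>(a, r). (b * a, r)) N) = b * weight N"
    by (simp add: weight_def sum_mset_distrib_left image_mset.compositionality o_def case_prod_beta)
  then show ?thesis by (simp add: assemble_def weight_ones)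
qed

context
  fixes b :: nat
  assumes b: "2 \<le> b"
begin

lemma count_assemble_one:
  assumes "i \<in> {1..\<rho>}"
  shows "count (assemble b \<rho> f N) (1, i) = f i"
proof -
  have "(1, i) \<notin># image_mset (\<lambda>(a, r). (b * a, r)) N" using b by auto
  then have "count (image_mset (\<lambda>(a, r). (b * a, r)) N) (1, i) = 0"
    by (simp only: not_in_iff)
  then show ?thesis
    using assms by (simp only: assemble_def count_ones count_union) simp
qed

lemma count_assemble_mult: "count (assemble b \<rho> f N) (b * a, i) = count N (a, i)"
proof -
  have "{# p \<in># N. (b * a, i) = (case p of (a, r) \<Rightarrow> (b * a, r)) #} = {# p \<in># N. (a, i) = p #}"
    using b by (intro filter_mset_cong) auto
  then have "count (image_mset (\<lambda>(a, r). (b * a, r)) N) (b * a, i) = count N (a, i)"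
    by (simp add: count_conv_size_mset filter_mset_image_mset eq_commute)
  moreover have "b * a \<noteq> 1" using b by auto
  ultimately show ?thesis by (simp only: assemble_def count_ones count_union) simp
qed

text \<open>
  Multiplication by \<open>b\<close> shifts the exponents, so the multiplicity bounds for \<open>b\<^sup>0\<close> concern only
  \<open>f\<close> and those for \<open>b\<^sup>1, b\<^sup>2, \<dots>\<close> only \<open>N\<close>. An equivalence serves both directions of the
  bijection: from left to right it says that the quotient left after removing the ones is again
  a restricted partition.
\<close>

lemma assemble_in_restricted_iff:
  "assemble b \<rho> f N \<in> restricted_bary_partitions b \<rho> \<Lambda> m \<longleftrightarrow>
     (\<forall>i\<in>{1..\<rho>}. f i \<le> \<Lambda> i) \<and> (\<Sum>i = 1..\<rho>. f i) + b * weight N = m \<and>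
     N \<in> restricted_bary_partitions b \<rho> \<Lambda> (weight N)"
  (is "?M \<in> _ \<longleftrightarrow> ?rhs")
proof
  assume M: "?M \<in> restricted_bary_partitions b \<rho> \<Lambda> m"
  have "f i \<le> \<Lambda> i" if "i \<in> {1..\<rho>}" for i
  proof -
    have "count ?M (b ^ 0, i) \<le> \<Lambda> i"
      using M that unfolding in_restricted_bary_partitions_iff by blast
    then show ?thesis using count_assemble_one[OF that, of f N] by simp
  qed
  moreover have "(\<Sum>i = 1..\<rho>. f i) + b * weight N = m"
    using M unfolding in_restricted_bary_partitions_iff weight_assemble by blast
  moreover have "1 \<le> a \<and> r \<in> {1..\<rho>} \<and> (\<exists>j. a = b ^ j)" if ar: "(a, r) \<in># N" for a r
  proof -
    have "(b * a, r) \<in># ?M" using ar by (force simp: assemble_def)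
    then obtain j where j: "1 \<le> b * a" "r \<in> {1..\<rho>}" "b * a = b ^ j"
      using M unfolding in_restricted_bary_partitions_iff by blast
    have "j \<noteq> 0" using j b by (intro notI) auto
    then obtain l where "j = Suc l" using not0_implies_Suc by blast
    then have "a = b ^ l" using j b by simp
    then show ?thesis using j by auto
  qed
  moreover have "count N (b ^ j, r) \<le> \<Lambda> r" if "r \<in> {1..\<rho>}" for j r
  proof -
    have "count ?M (b ^ Suc j, r) \<le> \<Lambda> r"
      using M that unfolding in_restricted_bary_partitions_iff by blast
    then show ?thesis by (simp add: count_assemble_mult)
  qed
  ultimately show ?rhs
    unfolding in_restricted_bary_partitions_iff by blast
next
  assume R: ?rhs
  have "1 \<le> a \<and> r \<in> {1..\<rho>} \<and> (\<exists>j. a = b ^ j)" if "(a, r) \<in># ?M" for a r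
  proof -
    consider "(a, r) \<in># ones \<rho> f" | a' where "a = b * a'" "(a', r) \<in># N"
      using \<open>(a, r) \<in># ?M\<close> by (auto simp: assemble_def)
    then show ?thesis
    proof cases
      case 1
      then have "a = b ^ 0 \<and> r \<in> {1..\<rho>}"
        by (simp add: count_ones flip: count_greater_zero_iff split: if_splits)
      then show ?thesis by (auto intro: exI[of _ 0])
    next
      case 2
      then obtain j where "1 \<le> a'" "r \<in> {1..\<rho>}" "a' = b ^ j"
        using R unfolding in_restricted_bary_partitions_iff by blast
      then have "1 \<le> a" "a = b ^ Suc j" using 2 b by auto
      then show ?thesis using \<open>r \<in> {1..\<rho>}\<close> by blast
    qed
  qed
  moreover have "count ?M (b ^ j, r) \<le> \<Lambda> r" if "r \<in> {1..\<rho>}" for j r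
  proof (cases j)
    case 0
    then show ?thesis using R that count_assemble_one[OF that, of f N] by simp
  next
    case (Suc l)
    then show ?thesis
      using R that by (simp add: count_assemble_mult in_restricted_bary_partitions_iff)
  qed
  ultimately show "?M \<in> restricted_bary_partitions b \<rho> \<Lambda> m"
    using R unfolding in_restricted_bary_partitions_iff weight_assemble by blast
qed

lemma decompose_assemble:
  assumes "f \<in> extensional {1..\<rho>}"
  shows "decompose b \<rho> (assemble b \<rho> f N) = (f, N)"
proof -
  have "restrict (\<lambda>i. count (assemble b \<rho> f N) (1, i)) {1..\<rho>} = restrict f {1..\<rho>}"
    by (rule restrict_ext) (rule count_assemble_one)
  then have fst: "restrict (\<lambda>i. count (assemble b \<rho> f N) (1, i)) {1..\<rho>} = f"
    using assms by (simp only: extensional_restrict)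
  have "{# p \<in># ones \<rho> f. fst p \<noteq> 1 #} = {#}"
    by (rule multiset_eqI) (auto simp: count_ones)
  moreover have "{# p \<in># image_mset (\<lambda>(a, r). (b * a, r)) N. fst p \<noteq> 1 #} =
      image_mset (\<lambda>(a, r). (b * a, r)) N"
    using b by (auto simp: filter_mset_eq_conv)
  moreover have "image_mset (\<lambda>(a, r). (a div b, r)) (image_mset (\<lambda>(a, r). (b * a, r)) N) = N"
    using b by (simp add: image_mset.compositionality o_def case_prod_beta)
  ultimately show ?thesis
    unfolding decompose_def fst by (simp add: assemble_def)
qed

text \<open>A power of \<open>b\<close> other than \<open>1\<close> is a multiple of \<open>b\<close>, so dividing by \<open>b\<close> loses nothing.\<close>

lemma assemble_decompose:
  assumes M: "M \<in> restricted_bary_partitions b \<rho> \<Lambda> m"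
  shows "case_prod (assemble b \<rho>) (decompose b \<rho> M) = M"
proof -
  have parts: "r \<in> {1..\<rho>} \<and> (\<exists>j. a = b ^ j)" if "(a, r) \<in># M" for a r
    using M that by (auto simp: in_restricted_bary_partitions_iff)
  have "ones \<rho> (restrict (\<lambda>i. count M (1, i)) {1..\<rho>}) = {# p \<in># M. fst p = 1 #}"
  proof (rule multiset_eqI)
    fix p :: "nat \<times> nat"
    obtain a i where p: "p = (a, i)" by (cases p)
    have "count M (a, i) = 0" if "i \<notin> {1..\<rho>}" using parts that by (auto simp: not_in_iff[symmetric])
    then show "count (ones \<rho> (restrict (\<lambda>i. count M (1, i)) {1..\<rho>})) p =
        count {# p \<in># M. fst p = 1 #} p"
      unfolding p by (auto simp: count_ones)
  qed
  moreover have "image_mset (\<lambda>(a, r). (b * a, r))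
      (image_mset (\<lambda>(a, r). (a div b, r)) {# p \<in># M. fst p \<noteq> 1 #}) = {# p \<in># M. fst p \<noteq> 1 #}"
  proof -
    have "b * (fst p div b) = fst p" if "p \<in># {# p \<in># M. fst p \<noteq> 1 #}" for p
    proof -
      obtain a r where p: "p = (a, r)" by (cases p)
      have "(a, r) \<in># M" using that p by simp
      then obtain j where j: "a = b ^ j" using parts by blast
      have "j \<noteq> 0" using that p j by (intro notI) auto
      then show ?thesis using p j by (simp add: dvd_power)
    qed
    then have "image_mset (\<lambda>p. (b * (fst p div b), snd p)) {# p \<in># M. fst p \<noteq> 1 #} =
        image_mset (\<lambda>p. p) {# p \<in># M. fst p \<noteq> 1 #}"
      by (intro image_mset_cong) auto
    then show ?thesis
      by (simp add: image_mset.compositionality o_def case_prod_beta)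
  qed
  ultimately show ?thesis
    unfolding decompose_def assemble_def by (simp flip: multiset_partition)
qed

section \<open>The recurrence\<close>

text \<open>
  The parts other than \<open>1\<close> contribute a multiple of \<open>b\<close>, so the number of ones is congruent to
  \<open>j\<close>; its quotient by \<open>b\<close> is the summation index \<open>k\<close> of the recurrence.
\<close>

lemma restricted_bary_partitions_eq_image:
  assumes j: "j < b"
  shows "restricted_bary_partitions b \<rho> \<Lambda> (b * n + j) =
    case_prod (assemble b \<rho>) `
      (\<Union>k \<in> {..min n ((\<Sum>i = 1..\<rho>. \<Lambda> i) div b)}.
         profiles \<rho> \<Lambda> (b * k + j) \<times> restricted_bary_partitions b \<rho> \<Lambda> (n - k))"
  (is "?L = _ ` ?R")
proof (intro equalityI subsetI)
  fix M assume M: "M \<in> ?L"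
  obtain f N where fN: "decompose b \<rho> M = (f, N)" by (cases "decompose b \<rho> M")
  have M_eq: "M = assemble b \<rho> f N" using assemble_decompose[OF M] fN by simp
  have f: "\<forall>i\<in>{1..\<rho>}. f i \<le> \<Lambda> i" and total: "(\<Sum>i = 1..\<rho>. f i) + b * weight N = b * n + j"
    and N: "N \<in> restricted_bary_partitions b \<rho> \<Lambda> (weight N)"
    using M unfolding M_eq assemble_in_restricted_iff by auto
  have ext: "f \<in> extensional {1..\<rho>}" using fN by (auto simp: decompose_def)
  define k where "k = (\<Sum>i = 1..\<rho>. f i) div b"
  have "(\<Sum>i = 1..\<rho>. f i) mod b = j"
    using arg_cong[OF total, of "\<lambda>x. x mod b"] j by simp
  then have sum_f: "(\<Sum>i = 1..\<rho>. f i) = b * k + j"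
    using mult_div_mod_eq[of b "\<Sum>i = 1..\<rho>. f i"] by (simp add: k_def)
  then have "b * (k + weight N) = b * n" using total by (simp add: algebra_simps)
  then have kn: "k + weight N = n" using b by simp
  have "(\<Sum>i = 1..\<rho>. f i) \<le> (\<Sum>i = 1..\<rho>. \<Lambda> i)" by (rule sum_mono) (use f in auto)
  then have "k \<le> (\<Sum>i = 1..\<rho>. \<Lambda> i) div b" unfolding k_def by (rule div_le_mono)
  then have "k \<in> {..min n ((\<Sum>i = 1..\<rho>. \<Lambda> i) div b)}" using kn by simp
  moreover have "f \<in> profiles \<rho> \<Lambda> (b * k + j)"
    using f ext sum_f by (auto simp: profiles_def PiE_def)
  moreover have "N \<in> restricted_bary_partitions b \<rho> \<Lambda> (n - k)" using N kn by auto
  ultimately have "(f, N) \<in> ?R" by blast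
  then show "M \<in> case_prod (assemble b \<rho>) ` ?R" using M_eq by force
next
  fix M assume "M \<in> case_prod (assemble b \<rho>) ` ?R"
  then obtain k f N where k: "k \<le> n" and f: "f \<in> profiles \<rho> \<Lambda> (b * k + j)"
    and N: "N \<in> restricted_bary_partitions b \<rho> \<Lambda> (n - k)" and M: "M = assemble b \<rho> f N"
    by auto
  have w: "weight N = n - k"
    using N by (simp add: in_restricted_bary_partitions_iff)
  have "b * k + j + b * (n - k) = b * n + j"
    using k by (simp add: diff_mult_distrib2)
  then show "M \<in> ?L"
    unfolding M assemble_in_restricted_iff using f N w by (auto simp: profiles_def PiE_def Pi_def)
qed

lemma card_restricted_bary_partitions:
  assumes j: "j < b"
  shows "card (restricted_bary_partitions b \<rho> \<Lambda> (b * n + j)) =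
    (\<Sum>k\<le>min n ((\<Sum>i = 1..\<rho>. \<Lambda> i) div b).
       card (profiles \<rho> \<Lambda> (b * k + j)) * card (restricted_bary_partitions b \<rho> \<Lambda> (n - k)))"
proof -
  let ?K = "{..min n ((\<Sum>i = 1..\<rho>. \<Lambda> i) div b)}"
  let ?P = "\<lambda>k. profiles \<rho> \<Lambda> (b * k + j) \<times> restricted_bary_partitions b \<rho> \<Lambda> (n - k)"
  have "inj_on (case_prod (assemble b \<rho>)) (\<Union>k\<in>?K. ?P k)"
    by (rule inj_on_inverseI[of _ "decompose b \<rho>"])
      (auto simp: profiles_def PiE_def decompose_assemble)
  then have "card (restricted_bary_partitions b \<rho> \<Lambda> (b * n + j)) = card (\<Union>k\<in>?K. ?P k)"
    unfolding restricted_bary_partitions_eq_image[OF j] by (rule card_image)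
  also have "\<dots> = (\<Sum>k\<in>?K. card (?P k))"
  proof (rule card_UN_disjoint)
    have "finite (restricted_bary_partitions b \<rho> \<Lambda> m)" for m
      using finite_colored_partitions by (simp add: restricted_bary_partitions_def)
    then show "\<forall>k\<in>?K. finite (?P k)" by (simp add: finite_profiles)
    show "\<forall>k\<in>?K. \<forall>l\<in>?K. k \<noteq> l \<longrightarrow> ?P k \<inter> ?P l = {}"
      using b by (auto simp: profiles_def)
  qed simp
  finally show ?thesis by (simp add: card_cartesian_product)
qed

end

lemma C_of_nat: "C b \<rho> \<Lambda> (int m) = card (restricted_bary_partitions b \<rho> \<Lambda> m)"
proof (cases "m = 0")
  case True
  (* C gives the value at 0 separately; as parts are positive, the empty partition is the
     only one of 0. *)
  have "M = {#}" if M: "M \<in> restricted_bary_partitions b \<rho> \<Lambda> 0" for M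
  proof -
    have False if "(a, r) \<in># M" for a r
    proof -
      have "weight M = 0"
        using M by (simp only: in_restricted_bary_partitions_iff)
      moreover have "1 \<le> a"
        using M that unfolding in_restricted_bary_partitions_iff by blast
      ultimately show False using fst_le_weight[OF that] by simp
    qed
    then show ?thesis by (cases M) auto
  qed
  moreover have "{#} \<in> restricted_bary_partitions b \<rho> \<Lambda> 0"
    by (simp add: in_restricted_bary_partitions_iff)
  ultimately have "restricted_bary_partitions b \<rho> \<Lambda> 0 = {{#}}" by blast
  then show ?thesis using True by (simp add: C_def)
qed (simp add: C_def)

theorem proposition4p3:
  fixes b \<rho> :: nat and \<Lambda> :: "nat \<Rightarrow> nat" and lam :: nat
  assumes "b \<ge> 2" and "\<rho> \<ge> 1"
    and "\<forall>i \<in> {1..\<rho>}. 1 \<le> \<Lambda> i"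
    and "mono_on {1..\<rho>} \<Lambda>"
    and "lam = (\<Sum>i = 1..\<rho>. \<Lambda> i)"
  shows "\<forall>n::nat. \<forall>j \<in> {0..b - 1}.
    C b \<rho> \<Lambda> (int (b * n + j)) =
      (\<Sum>k = 0..lam div b. Y \<rho> \<Lambda> (b * k + j) * C b \<rho> \<Lambda> (int n - int k))"
proof (intro allI ballI)
  fix n j :: nat
  assume "j \<in> {0..b - 1}"
  then have j: "j < b" using \<open>b \<ge> 2\<close> by auto
  have "C b \<rho> \<Lambda> (int (b * n + j)) =
      (\<Sum>k\<le>min n (lam div b).
         card (profiles \<rho> \<Lambda> (b * k + j)) * card (restricted_bary_partitions b \<rho> \<Lambda> (n - k)))"
    unfolding C_of_nat \<open>lam = _\<close> by (rule card_restricted_bary_partitions[OF \<open>b \<ge> 2\<close> j])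
  also have "\<dots> = (\<Sum>k\<le>min n (lam div b). Y \<rho> \<Lambda> (b * k + j) * C b \<rho> \<Lambda> (int n - int k))"
  proof (rule sum.cong)
    fix k assume "k \<in> {..min n (lam div b)}"
    then have "int n - int k = int (n - k)" by simp
    then show "card (profiles \<rho> \<Lambda> (b * k + j)) *
        card (restricted_bary_partitions b \<rho> \<Lambda> (n - k)) =
        Y \<rho> \<Lambda> (b * k + j) * C b \<rho> \<Lambda> (int n - int k)"
      by (simp only: Y_eq_card_profiles C_of_nat)
  qed simp
  also have "\<dots> = (\<Sum>k = 0..lam div b. Y \<rho> \<Lambda> (b * k + j) * C b \<rho> \<Lambda> (int n - int k))"
    (* The terms with k > n vanish because C is 0 at negative arguments. *)
    by (rule sum.mono_neutral_left) (auto simp: C_def)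
  finally show "C b \<rho> \<Lambda> (int (b * n + j)) =
      (\<Sum>k = 0..lam div b. Y \<rho> \<Lambda> (b * k + j) * C b \<rho> \<Lambda> (int n - int k))" .
qed

end
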